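(* Let $\mathcal{G}$ be a locally compact étale groupoid. For any $\mathcal{G}$-equivariant $T\in\mathcal{L}(L^2(\mathcal{G}))$, there exists a unique function $f_T\in C_b(\mathcal{G})$ such that $T$ is the convolution operator by $f_T$, i.e. such that for all $\xi\in L^2(\mathcal{G})$ and $\gamma\in\mathcal{G}$ the series below converges absolutely and $(T\xi)(\gamma)=\sum_{\alpha\in\mathcal{G}_{\mathrm{s}(\gamma)}}f_T(\gamma\alpha^{-1})\xi(\alpha)$.
   Context: Locally compact spaces are assumed Hausdorff. A locally compact étale groupoid $\mathcal{G}$ is a topological groupoid with locally compact topology whose range map $\mathrm{r}$ (hence source map $\mathrm{s}$) is a local homeomorphism; $\mathcal{G}^{(0)}$ is its unit space and $\mathcal{G}_x=\mathrm{s}^{-1}(x)$ (discrete). $C_b(\mathcal{G})$ is the set of bounded continuous complex functions. $L^2(\mathcal{G})$ is the Hilbert $C_0(\mathcal{G}^{(0)})$-module obtained by completing $C_c(\mathcal{G})$ for $\langle\eta,\xi\rangle(x)=\sum_{\gamma\in\mathcal{G}_x}\overline{\eta(\gamma)}\xi(\gamma)$, with $(\xi f)(\gamma)=\xi(\gamma)f(\mathrm{s}(\gamma))$; its elements are regarded as functions in $C_0(\mathcal{G})$. $\mathcal{L}(L^2(\mathcal{G}))$ is the $C^*$-algebra of adjointable operators. For $g\in C_c(\mathcal{G})$, $\rho(g)$ is the bounded linear operator on the Banach space $L^2(\mathcal{G})$ given by $(\rho(g)\xi)(\gamma)=\sum_{\beta\in\mathcal{G}_{\mathrm{s}(\gamma)}}g(\beta)\xi(\gamma\beta^{-1})$.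 An operator $T\in\mathcal{L}(L^2(\mathcal{G}))$ is $\mathcal{G}$-equivariant if $T\rho(g)=\rho(g)T$ for all $g\in C_c(\mathcal{G})$. *)

theory Defs
  imports "HOL-Analysis.Analysis"
begin

section \<open>Locally compact etale groupoids\<close>

text \<open>
  A groupoid is given by its arrows (the points of the topology), range and source maps with
  values in the units, a product and an inverse. The product \<open>\<gamma> \<odot> \<beta>\<close> is meaningful only when
  the source of \<open>\<gamma>\<close> is the range of \<open>\<beta>\<close>; nothing is assumed about the values of these operations
  elsewhere.
\<close>

record 'g top_groupoid =
  topol :: "'g topology"
  rng :: "'g \<Rightarrow> 'g"
  src :: "'g \<Rightarrow> 'g"
  gmult :: "'g \<Rightarrow> 'g \<Rightarrow> 'g"  (infixl \<open>\<odot>\<index>\<close> 70)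
  ginv :: "'g \<Rightarrow> 'g"

definition arrows :: "('g, 'z) top_groupoid_scheme \<Rightarrow> 'g set"
  where "arrows \<G> = topspace (topol \<G>)"

definition units :: "('g, 'z) top_groupoid_scheme \<Rightarrow> 'g set"
  where "units \<G> = src \<G> ` arrows \<G>"

definition fibre :: "('g, 'z) top_groupoid_scheme \<Rightarrow> 'g \<Rightarrow> 'g set"
  where "fibre \<G> x = {\<gamma> \<in> arrows \<G>. src \<G> \<gamma> = x}"

definition composable :: "('g, 'z) top_groupoid_scheme \<Rightarrow> ('g \<times> 'g) set"
  where "composable \<G> = {(\<gamma>, \<beta>). \<gamma> \<in> arrows \<G> \<and> \<beta> \<in> arrows \<G> \<and> src \<G> \<gamma> = rng \<G> \<beta>}"

locale groupoid =
  fixes \<G> :: "('g, 'z) top_groupoid_scheme" (structure)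
  assumes src_closed: "\<gamma> \<in> arrows \<G> \<Longrightarrow> src \<G> \<gamma> \<in> arrows \<G>"
    and rng_closed: "\<gamma> \<in> arrows \<G> \<Longrightarrow> rng \<G> \<gamma> \<in> arrows \<G>"
    and src_src: "\<gamma> \<in> arrows \<G> \<Longrightarrow> src \<G> (src \<G> \<gamma>) = src \<G> \<gamma>"
    and rng_src: "\<gamma> \<in> arrows \<G> \<Longrightarrow> rng \<G> (src \<G> \<gamma>) = src \<G> \<gamma>"
    and src_rng: "\<gamma> \<in> arrows \<G> \<Longrightarrow> src \<G> (rng \<G> \<gamma>) = rng \<G> \<gamma>"
    and rng_rng: "\<gamma> \<in> arrows \<G> \<Longrightarrow> rng \<G> (rng \<G> \<gamma>) = rng \<G> \<gamma>"
    and mult_closed: "(\<gamma>, \<beta>) \<in> composable \<G> \<Longrightarrow> \<gamma> \<odot> \<beta> \<in> arrows \<G>"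
    and src_mult: "(\<gamma>, \<beta>) \<in> composable \<G> \<Longrightarrow> src \<G> (\<gamma> \<odot> \<beta>) = src \<G> \<beta>"
    and rng_mult: "(\<gamma>, \<beta>) \<in> composable \<G> \<Longrightarrow> rng \<G> (\<gamma> \<odot> \<beta>) = rng \<G> \<gamma>"
    and mult_assoc: "(\<gamma>, \<beta>) \<in> composable \<G> \<Longrightarrow> (\<beta>, \<alpha>) \<in> composable \<G> \<Longrightarrow>
          (\<gamma> \<odot> \<beta>) \<odot> \<alpha> = \<gamma> \<odot> (\<beta> \<odot> \<alpha>)"
    and rng_unit: "\<gamma> \<in> arrows \<G> \<Longrightarrow> rng \<G> \<gamma> \<odot> \<gamma> = \<gamma>"
    and src_unit: "\<gamma> \<in> arrows \<G> \<Longrightarrow> \<gamma> \<odot> src \<G> \<gamma> = \<gamma>"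
    and inv_closed: "\<gamma> \<in> arrows \<G> \<Longrightarrow> ginv \<G> \<gamma> \<in> arrows \<G>"
    and src_inv: "\<gamma> \<in> arrows \<G> \<Longrightarrow> src \<G> (ginv \<G> \<gamma>) = rng \<G> \<gamma>"
    and rng_inv: "\<gamma> \<in> arrows \<G> \<Longrightarrow> rng \<G> (ginv \<G> \<gamma>) = src \<G> \<gamma>"
    and mult_inv: "\<gamma> \<in> arrows \<G> \<Longrightarrow> \<gamma> \<odot> ginv \<G> \<gamma> = rng \<G> \<gamma>"
    and inv_mult: "\<gamma> \<in> arrows \<G> \<Longrightarrow> ginv \<G> \<gamma> \<odot> \<gamma> = src \<G> \<gamma>"

locale topological_groupoid = groupoid +
  assumes continuous_mult:
      "continuous_map (subtopology (prod_topology (topol \<G>) (topol \<G>)) (composable \<G>)) (topol \<G>)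
         (\<lambda>(\<gamma>, \<beta>). \<gamma> \<odot> \<beta>)"
    and continuous_inv: "continuous_map (topol \<G>) (topol \<G>) (ginv \<G>)"

definition local_homeomorphism :: "'a topology \<Rightarrow> 'b topology \<Rightarrow> ('a \<Rightarrow> 'b) \<Rightarrow> bool"
  where "local_homeomorphism X Y f \<longleftrightarrow>
    f \<in> topspace X \<rightarrow> topspace Y \<and>
    (\<forall>x \<in> topspace X. \<exists>U. openin X U \<and> x \<in> U \<and> openin Y (f ` U) \<and>
        homeomorphic_map (subtopology X U) (subtopology Y (f ` U)) f)"

locale lc_etale_groupoid = topological_groupoid +
  assumes locally_compact: "locally_compact_space (topol \<G>)"
    and Hausdorff: "Hausdorff_space (topol \<G>)"
    and etale: "local_homeomorphism (topol \<G>) (subtopology (topol \<G>) (units \<G>)) (rng \<G>)"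


section \<open>Function spaces\<close>

text \<open>
  Functions on the groupoid are total functions that vanish off the arrows, so that equality of
  functions on the groupoid is equality in HOL.
\<close>

definition fun_space :: "('g, 'z) top_groupoid_scheme \<Rightarrow> ('g \<Rightarrow> complex) set"
  where "fun_space \<G> = {f. \<forall>\<gamma>. \<gamma> \<notin> arrows \<G> \<longrightarrow> f \<gamma> = 0}"

definition C_b :: "('g, 'z) top_groupoid_scheme \<Rightarrow> ('g \<Rightarrow> complex) set"
  where "C_b \<G> = {f \<in> fun_space \<G>. continuous_map (topol \<G>) euclidean f \<and> bounded (f ` arrows \<G>)}"

definition C_c :: "('g, 'z) top_groupoid_scheme \<Rightarrow> ('g \<Rightarrow> complex) set"
  where "C_c \<G> = {f \<in> fun_space \<G>. continuous_map (topol \<G>) euclidean f \<and>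
    compactin (topol \<G>) (topol \<G> closure_of {\<gamma> \<in> arrows \<G>. f \<gamma> \<noteq> 0})}"

definition L2_inner ::
    "('g, 'z) top_groupoid_scheme \<Rightarrow> ('g \<Rightarrow> complex) \<Rightarrow> ('g \<Rightarrow> complex) \<Rightarrow> 'g \<Rightarrow> complex"
  where "L2_inner \<G> \<eta> \<xi> x = (\<Sum>\<^sub>\<infinity>\<gamma>\<in>fibre \<G> x. cnj (\<eta> \<gamma>) * \<xi> \<gamma>)"

text \<open>
  \<open>L2_norm_le \<G> \<xi> e\<close> says that the module norm
  \<open>sup\<^sub>x \<langle>\<xi>,\<xi>\<rangle>(x)\<^sup>1\<^sup>/\<^sup>2\<close> of \<open>\<xi>\<close> is finite and at most \<open>e\<close>, for \<open>e \<ge> 0\<close>.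
\<close>

definition L2_norm_le :: "('g, 'z) top_groupoid_scheme \<Rightarrow> ('g \<Rightarrow> complex) \<Rightarrow> real \<Rightarrow> bool"
  where "L2_norm_le \<G> \<xi> e \<longleftrightarrow>
    (\<forall>x \<in> units \<G>. (\<lambda>\<gamma>. (norm (\<xi> \<gamma>))\<^sup>2) summable_on fibre \<G> x \<and>
        (\<Sum>\<^sub>\<infinity>\<gamma>\<in>fibre \<G> x. (norm (\<xi> \<gamma>))\<^sup>2) \<le> e\<^sup>2)"

text \<open>
  The functions of finite module norm form a Banach space (the bounded families in the
  \<open>\<ell>\<^sup>2\<close>-spaces of the fibres). Hence the completion of \<open>C_c \<G>\<close> is its closure in that space.
  As the module norm dominates the supremum norm, the elements of this closure are
  continuous and vanish at infinity.
\<close>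

definition L2 :: "('g, 'z) top_groupoid_scheme \<Rightarrow> ('g \<Rightarrow> complex) set"
  where "L2 \<G> = {\<xi> \<in> fun_space \<G>. \<forall>e>0. \<exists>\<eta> \<in> C_c \<G>. L2_norm_le \<G> (\<lambda>\<gamma>. \<xi> \<gamma> - \<eta> \<gamma>) e}"


section \<open>Adjointable and equivariant operators\<close>

text \<open>
  Only the values of an operator on \<open>L2 \<G>\<close> matter. As usual for Hilbert modules, linearity over
  \<open>C\<^sub>0\<close> of the unit space and boundedness are consequences of the existence of an adjoint.
\<close>

definition adjointable ::
    "('g, 'z) top_groupoid_scheme \<Rightarrow> (('g \<Rightarrow> complex) \<Rightarrow> ('g \<Rightarrow> complex)) set"
  where "adjointable \<G> = {T. T \<in> L2 \<G> \<rightarrow> L2 \<G> \<and>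
    (\<exists>S \<in> L2 \<G> \<rightarrow> L2 \<G>. \<forall>\<eta> \<in> L2 \<G>. \<forall>\<xi> \<in> L2 \<G>. \<forall>x \<in> units \<G>.
        L2_inner \<G> (T \<eta>) \<xi> x = L2_inner \<G> \<eta> (S \<xi>) x)}"

definition right_conv ::
    "('g, 'z) top_groupoid_scheme \<Rightarrow> ('g \<Rightarrow> complex) \<Rightarrow> ('g \<Rightarrow> complex) \<Rightarrow> ('g \<Rightarrow> complex)"
  where "right_conv \<G> g \<xi> \<gamma> =
    (if \<gamma> \<in> arrows \<G>
     then \<Sum>\<^sub>\<infinity>\<beta>\<in>fibre \<G> (src \<G> \<gamma>). g \<beta> * \<xi> (\<gamma> \<odot>\<^bsub>\<G>\<^esub> ginv \<G> \<beta>) else 0)"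

definition equivariant ::
    "('g, 'z) top_groupoid_scheme \<Rightarrow> (('g \<Rightarrow> complex) \<Rightarrow> ('g \<Rightarrow> complex)) \<Rightarrow> bool"
  where "equivariant \<G> T \<longleftrightarrow>
    (\<forall>g \<in> C_c \<G>. \<forall>\<xi> \<in> L2 \<G>. T (right_conv \<G> g \<xi>) = right_conv \<G> g (T \<xi>))"

end

theory Submission
  imports Defs
begin

text \<open>
  Pairing \<open>T \<xi>\<close> with a bump at \<open>\<gamma>\<close> supported in a bisection and moving \<open>T\<close> to its adjoint writes
  \<open>(T \<xi>)(\<gamma>)\<close> as \<open>\<Sum>\<^sub>\<alpha> K(\<gamma>,\<alpha>) \<xi>(\<alpha>)\<close> with \<open>K(\<gamma>,\<cdot>)\<close> square summable on the fibre, so absolute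
  convergence is Cauchy--Schwarz. Equivariance, applied to a bump on the units and a bump at \<open>\<alpha>\<close>,
  gives \<open>K(\<gamma>,\<alpha>) = f(\<gamma>\<alpha>\<^sup>-\<^sup>1)\<close> for \<open>f(\<gamma>) = K(\<gamma>, s(\<gamma>))\<close>. For \<open>h\<close> supported on the unit space, which
  is open, \<open>T h = f \<cdot> (h \<circ> s)\<close>; this yields continuity, boundedness and uniqueness of \<open>f\<close>.
\<close>

section \<open>Gluing continuous maps; square-summable families\<close>

lemma continuous_map_euclidean_mult:
  fixes f g :: "'a \<Rightarrow> 'b::real_normed_algebra"
  assumes "continuous_map X euclidean f" "continuous_map X euclidean g"
  shows "continuous_map X euclidean (\<lambda>x. f x * g x)"
  using assms by (auto simp: continuous_map_atin intro!: tendsto_mult)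

text \<open>The neighbourhoods cover the space and the local functions agree on overlaps, since each
  agrees with \<open>f\<close> there; the pasting lemma then applies.\<close>

lemma continuous_map_locally_eq:
  assumes "\<And>x. x \<in> topspace X \<Longrightarrow>
    \<exists>U g. openin X U \<and> x \<in> U \<and> continuous_map (subtopology X U) Y g \<and> (\<forall>y\<in>U. f y = g y)"
  shows "continuous_map X Y f"
proof -
  obtain U g where Ug: "\<And>x. x \<in> topspace X \<Longrightarrow>
     openin X (U x) \<and> x \<in> U x \<and> continuous_map (subtopology X (U x)) Y (g x) \<and> (\<forall>y\<in>U x. f y = g x y)"
    using assms by metis
  show ?thesis
  proof (rule pasting_lemma[where I = "topspace X" and T = U and f = g])
    show "g i x = g j x" if "i \<in> topspace X" "j \<in> topspace X" "x \<in> topspace X \<inter> U i \<inter> U j" for i j x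
      using Ug[OF that(1)] Ug[OF that(2)] that(3) by (metis IntE)
    show "\<exists>j. j \<in> topspace X \<and> x \<in> U j \<and> f x = g j x" if "x \<in> topspace X" for x
      using Ug[OF that] that by blast
  qed (use Ug in blast)+
qed

lemma has_sum_single:
  assumes "i \<in> A" "\<And>j. j \<in> A \<Longrightarrow> j \<noteq> i \<Longrightarrow> f j = 0"
  shows "(f has_sum f i) A"
  by (rule has_sum_finite_neutralI[where B = "{i}"]) (use assms in auto)

lemma square_summable_add:
  fixes f g :: "'a \<Rightarrow> 'b::real_normed_vector"
  assumes f: "(\<lambda>x. (norm (f x))\<^sup>2) summable_on A" and g: "(\<lambda>x. (norm (g x))\<^sup>2) summable_on A"
  shows "(\<lambda>x. (norm (f x + g x))\<^sup>2) summable_on A"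
proof (rule summable_on_comparison_test)
  show "(\<lambda>x. 2 * (norm (f x))\<^sup>2 + 2 * (norm (g x))\<^sup>2) summable_on A"
    using f g by (intro summable_on_add summable_on_cmult_right)
  fix x
  have "(norm (f x + g x))\<^sup>2 \<le> (norm (f x) + norm (g x))\<^sup>2"
    by (simp add: norm_triangle_ineq power_mono)
  also have "\<dots> \<le> 2 * (norm (f x))\<^sup>2 + 2 * (norm (g x))\<^sup>2"
    using sum_squares_bound[of "norm (f x)" "norm (g x)"] by (simp add: power2_sum)
  finally show "(norm (f x + g x))\<^sup>2 \<le> 2 * (norm (f x))\<^sup>2 + 2 * (norm (g x))\<^sup>2" .
qed auto

text \<open>Follows from 2ab \<le> a^2 + b^2 by comparison. This is the form of Cauchy-Schwarz that
  gives absolute convergence of the convolution series.\<close>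

lemma square_summable_imp_abs_summable_mult:
  fixes f g :: "'a \<Rightarrow> 'b::real_normed_div_algebra"
  assumes f: "(\<lambda>x. (norm (f x))\<^sup>2) summable_on A" and g: "(\<lambda>x. (norm (g x))\<^sup>2) summable_on A"
  shows "(\<lambda>x. norm (f x * g x)) summable_on A"
proof (rule summable_on_comparison_test)
  show "(\<lambda>x. (norm (f x))\<^sup>2 + (norm (g x))\<^sup>2) summable_on A"
    using f g by (intro summable_on_add)
  fix x
  have "norm (f x) * norm (g x) \<ge> 0" by simp
  then show "norm (f x * g x) \<le> (norm (f x))\<^sup>2 + (norm (g x))\<^sup>2"
    using sum_squares_bound[of "norm (f x)" "norm (g x)"] unfolding norm_mult by linarith
qed auto

section \<open>Inverses, quotients and fibres; first estimates for the module norm\<close>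

context groupoid
begin

lemma src_in_units: "\<gamma> \<in> arrows \<G> \<Longrightarrow> src \<G> \<gamma> \<in> units \<G>"
  by (auto simp: units_def)

lemma units_arrows: "x \<in> units \<G> \<Longrightarrow> x \<in> arrows \<G>"
  by (auto simp: units_def src_closed)

lemma src_of_unit: "x \<in> units \<G> \<Longrightarrow> src \<G> x = x"
  by (auto simp: units_def src_src)

lemma rng_of_unit: "x \<in> units \<G> \<Longrightarrow> rng \<G> x = x"
  by (auto simp: units_def rng_src)

lemma rng_in_units: "\<gamma> \<in> arrows \<G> \<Longrightarrow> rng \<G> \<gamma> \<in> units \<G>"
  by (metis src_in_units src_rng rng_closed)

lemma ginv_unit: "x \<in> units \<G> \<Longrightarrow> ginv \<G> x = x"
  by (metis inv_closed rng_inv rng_of_unit rng_unit mult_inv src_of_unit units_arrows)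

lemma ginv_ginv:
  assumes "\<gamma> \<in> arrows \<G>"
  shows "ginv \<G> (ginv \<G> \<gamma>) = \<gamma>"
proof -
  let ?i = "ginv \<G> \<gamma>"
  have i: "?i \<in> arrows \<G>" "ginv \<G> ?i \<in> arrows \<G>" using assms inv_closed by auto
  \<comment> \<open>Both bracketings of this triple product collapse, one to \<gamma> and the other
    to the double inverse.\<close>
  have "(ginv \<G> ?i \<odot> ?i) \<odot> \<gamma> = ginv \<G> ?i \<odot> (?i \<odot> \<gamma>)"
    by (rule mult_assoc) (use assms i in \<open>auto simp: composable_def src_inv rng_inv\<close>)
  moreover have "(ginv \<G> ?i \<odot> ?i) \<odot> \<gamma> = \<gamma>"
    using assms i by (simp add: inv_mult src_inv rng_unit)
  moreover have "ginv \<G> ?i \<odot> (?i \<odot> \<gamma>) = ginv \<G> ?i"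
    using src_unit[OF i(2)] assms i by (simp add: inv_mult src_inv rng_inv)
  ultimately show ?thesis by simp
qed

lemma mult_src_inv: "\<gamma> \<in> arrows \<G> \<Longrightarrow> \<gamma> \<odot> ginv \<G> (src \<G> \<gamma>) = \<gamma>"
  by (simp add: ginv_unit src_in_units src_unit)

lemma div_closed:
  assumes "\<gamma> \<in> arrows \<G>" "\<alpha> \<in> fibre \<G> (src \<G> \<gamma>)"
  shows "\<gamma> \<odot> ginv \<G> \<alpha> \<in> arrows \<G>" "src \<G> (\<gamma> \<odot> ginv \<G> \<alpha>) = rng \<G> \<alpha>"
proof -
  have "(\<gamma>, ginv \<G> \<alpha>) \<in> composable \<G>"
    using assms by (auto simp: composable_def fibre_def inv_closed rng_inv)
  then show "\<gamma> \<odot> ginv \<G> \<alpha> \<in> arrows \<G>" "src \<G> (\<gamma> \<odot> ginv \<G> \<alpha>) = rng \<G> \<alpha>"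
    using assms by (auto simp: mult_closed src_mult src_inv fibre_def)
qed

text \<open>A unit equals its own source, so the quotient is r(\<alpha>); multiplying by \<alpha> on
  the right gives \<gamma> = r(\<alpha>)\<alpha> = \<alpha>.\<close>

lemma div_unit_imp_eq:
  assumes "\<gamma> \<in> arrows \<G>" "\<alpha> \<in> fibre \<G> (src \<G> \<gamma>)" "\<gamma> \<odot> ginv \<G> \<alpha> \<in> units \<G>"
  shows "\<alpha> = \<gamma>"
proof -
  have a: "\<alpha> \<in> arrows \<G>" "src \<G> \<alpha> = src \<G> \<gamma>" using assms by (auto simp: fibre_def)
  have c: "(\<gamma>, ginv \<G> \<alpha>) \<in> composable \<G>" "(ginv \<G> \<alpha>, \<alpha>) \<in> composable \<G>"
    using a assms by (auto simp: composable_def inv_closed rng_inv src_inv)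
  have "(\<gamma> \<odot> ginv \<G> \<alpha>) \<odot> \<alpha> = \<gamma>"
    using mult_assoc[OF c] a assms(1) by (simp add: inv_mult src_unit)
  moreover have "\<gamma> \<odot> ginv \<G> \<alpha> = rng \<G> \<alpha>"
    using div_closed(2)[OF assms(1,2)] src_of_unit[OF assms(3)] by simp
  ultimately show ?thesis using a by (simp add: rng_unit)
qed

lemma self_in_fibre: "\<gamma> \<in> arrows \<G> \<Longrightarrow> \<gamma> \<in> fibre \<G> (src \<G> \<gamma>)"
  by (auto simp: fibre_def)

lemma src_in_fibre: "\<gamma> \<in> arrows \<G> \<Longrightarrow> src \<G> \<gamma> \<in> fibre \<G> (src \<G> \<gamma>)"
  by (auto simp: fibre_def src_src src_closed)

lemma unit_in_fibre: "\<alpha> \<in> fibre \<G> x \<Longrightarrow> \<alpha> \<in> units \<G> \<Longrightarrow> \<alpha> = x"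
  by (auto simp: fibre_def src_of_unit)

text \<open>One term of a nonnegative sum over the fibre is at most the whole sum. Thus the module
  norm dominates the supremum norm.\<close>

lemma L2_norm_le_imp_norm_le:
  assumes "L2_norm_le \<G> \<xi> e" "0 \<le> e" "\<gamma> \<in> arrows \<G>"
  shows "norm (\<xi> \<gamma>) \<le> e"
proof -
  let ?A = "fibre \<G> (src \<G> \<gamma>)"
  have s: "(\<lambda>\<gamma>. (norm (\<xi> \<gamma>))\<^sup>2) summable_on ?A" and le: "(\<Sum>\<^sub>\<infinity>\<gamma>\<in>?A. (norm (\<xi> \<gamma>))\<^sup>2) \<le> e\<^sup>2"
    using assms src_in_units by (auto simp: L2_norm_le_def)
  have "(\<Sum>\<gamma>\<in>{\<gamma>}. (norm (\<xi> \<gamma>))\<^sup>2) \<le> (\<Sum>\<^sub>\<infinity>\<gamma>\<in>?A. (norm (\<xi> \<gamma>))\<^sup>2)"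
    by (rule finite_sum_le_infsum[OF s]) (use self_in_fibre assms in auto)
  with le have "(norm (\<xi> \<gamma>))\<^sup>2 \<le> e\<^sup>2" by simp
  with \<open>0 \<le> e\<close> show ?thesis by (simp add: power2_le_iff_abs_le)
qed

text \<open>A fibre meets the unit space only in its base point, so each fibre sum has at most one
  nonzero term. For functions supported on the units, supremum bounds are therefore module norm
  bounds.\<close>

lemma L2_norm_le_units:
  assumes "\<And>\<gamma>. \<gamma> \<notin> units \<G> \<Longrightarrow> \<xi> \<gamma> = 0" "\<And>\<gamma>. norm (\<xi> \<gamma>) \<le> e"
  shows "L2_norm_le \<G> \<xi> e"
  unfolding L2_norm_le_def
proof
  fix x assume x: "x \<in> units \<G>"
  then have "x \<in> fibre \<G> x" using self_in_fibre src_of_unit units_arrows by metis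
  then have *: "((\<lambda>\<gamma>. (norm (\<xi> \<gamma>))\<^sup>2) has_sum (norm (\<xi> x))\<^sup>2) (fibre \<G> x)"
    by (rule has_sum_single) (use assms(1) unit_in_fibre in fastforce)
  moreover have "(norm (\<xi> x))\<^sup>2 \<le> e\<^sup>2" using assms(2) by (simp add: power_mono)
  ultimately show "(\<lambda>\<gamma>. (norm (\<xi> \<gamma>))\<^sup>2) summable_on fibre \<G> x \<and> (\<Sum>\<^sub>\<infinity>\<gamma>\<in>fibre \<G> x. (norm (\<xi> \<gamma>))\<^sup>2) \<le> e\<^sup>2"
    using has_sum_imp_summable infsumI by metis
qed

end

section \<open>Compactly supported continuous functions\<close>

lemma C_c_fun_space: "f \<in> C_c \<G> \<Longrightarrow> f \<in> fun_space \<G>"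
  and C_c_continuous: "f \<in> C_c \<G> \<Longrightarrow> continuous_map (topol \<G>) euclidean f"
  by (auto simp: C_c_def)

text \<open>Replaces the closed support by some compact set containing all points where
  \<open>f\<close> is nonzero, a form that passes easily through sums and products;
  \<open>C_cI\<close> is the way back.\<close>

lemma C_c_support:
  assumes "f \<in> C_c \<G>"
  obtains K where "compactin (topol \<G>) K" "\<And>\<gamma>. f \<gamma> \<noteq> 0 \<Longrightarrow> \<gamma> \<in> K"
proof
  show "compactin (topol \<G>) (topol \<G> closure_of {\<gamma> \<in> arrows \<G>. f \<gamma> \<noteq> 0})"
    using assms by (auto simp: C_c_def)
  fix \<gamma> assume "f \<gamma> \<noteq> 0"
  then have "\<gamma> \<in> {\<gamma> \<in> arrows \<G>. f \<gamma> \<noteq> 0}" using assms by (auto simp: C_c_def fun_space_def)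
  then show "\<gamma> \<in> topol \<G> closure_of {\<gamma> \<in> arrows \<G>. f \<gamma> \<noteq> 0}"
    using closure_of_subset[of "{\<gamma> \<in> arrows \<G>. f \<gamma> \<noteq> 0}" "topol \<G>"] by (auto simp: arrows_def)
qed

lemma C_c_subset_L2: "C_c \<G> \<subseteq> L2 \<G>"
proof
  fix f assume "f \<in> C_c \<G>"
  moreover have "L2_norm_le \<G> (\<lambda>\<gamma>. f \<gamma> - f \<gamma>) e" for e by (simp add: L2_norm_le_def)
  ultimately show "f \<in> L2 \<G>" unfolding L2_def using C_c_fun_space by blast
qed

lemma C_c_bounded:
  assumes "f \<in> C_c \<G>"
  shows "bounded (range f)"
proof -
  obtain K where K: "compactin (topol \<G>) K" "\<And>\<gamma>. f \<gamma> \<noteq> 0 \<Longrightarrow> \<gamma> \<in> K"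
    using C_c_support[OF assms] by blast
  have "compactin euclidean (f ` K)"
    using image_compactin[OF K(1) C_c_continuous[OF assms]] .
  then have "bounded (insert 0 (f ` K))" by (simp add: compact_imp_bounded)
  moreover have "range f \<subseteq> insert 0 (f ` K)" using K(2) by fastforce
  ultimately show ?thesis by (rule bounded_subset)
qed

context lc_etale_groupoid
begin

text \<open>Compact sets are closed in a Hausdorff space, so the closed support lies inside
  \<open>K\<close> and is compact as a closed subset of it.\<close>

lemma C_cI:
  assumes "f \<in> fun_space \<G>" "continuous_map (topol \<G>) euclidean f"
    and "compactin (topol \<G>) K" "\<And>\<gamma>. f \<gamma> \<noteq> 0 \<Longrightarrow> \<gamma> \<in> K"
  shows "f \<in> C_c \<G>"
proof -
  have "topol \<G> closure_of {\<gamma> \<in> arrows \<G>. f \<gamma> \<noteq> 0} \<subseteq> K"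
    by (rule closure_of_minimal) (use assms compactin_imp_closedin Hausdorff in auto)
  then have "compactin (topol \<G>) (topol \<G> closure_of {\<gamma> \<in> arrows \<G>. f \<gamma> \<noteq> 0})"
    by (rule closed_compactin[OF assms(3) _ closedin_closure_of])
  then show ?thesis using assms(1,2) by (simp add: C_c_def)
qed

lemma C_c_mult:
  assumes "f \<in> C_c \<G>" "continuous_map (topol \<G>) euclidean g"
  shows "(\<lambda>\<gamma>. f \<gamma> * g \<gamma>) \<in> C_c \<G>"
proof -
  obtain K where K: "compactin (topol \<G>) K" "\<And>\<gamma>. f \<gamma> \<noteq> 0 \<Longrightarrow> \<gamma> \<in> K"
    using C_c_support[OF assms(1)] by blast
  show ?thesis
  proof (rule C_cI[OF _ _ K(1)])
    show "continuous_map (topol \<G>) euclidean (\<lambda>\<gamma>. f \<gamma> * g \<gamma>)"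
      by (rule continuous_map_euclidean_mult[OF C_c_continuous[OF assms(1)] assms(2)])
    show "(\<lambda>\<gamma>. f \<gamma> * g \<gamma>) \<in> fun_space \<G>"
      using C_c_fun_space[OF assms(1)] by (simp add: fun_space_def)
  qed (use K(2) in auto)
qed

lemma C_c_add:
  assumes "f \<in> C_c \<G>" "g \<in> C_c \<G>"
  shows "(\<lambda>\<gamma>. f \<gamma> + g \<gamma>) \<in> C_c \<G>"
proof -
  obtain K where K: "compactin (topol \<G>) K" "\<And>\<gamma>. f \<gamma> \<noteq> 0 \<Longrightarrow> \<gamma> \<in> K"
    using C_c_support[OF assms(1)] by blast
  obtain L where L: "compactin (topol \<G>) L" "\<And>\<gamma>. g \<gamma> \<noteq> 0 \<Longrightarrow> \<gamma> \<in> L"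
    using C_c_support[OF assms(2)] by blast
  show ?thesis
  proof (rule C_cI[OF _ _ compactin_Un[OF K(1) L(1)]])
    show "continuous_map (topol \<G>) euclidean (\<lambda>\<gamma>. f \<gamma> + g \<gamma>)"
      using assms by (intro continuous_map_add C_c_continuous)
    show "(\<lambda>\<gamma>. f \<gamma> + g \<gamma>) \<in> fun_space \<G>"
      using C_c_fun_space[OF assms(1)] C_c_fun_space[OF assms(2)] by (simp add: fun_space_def)
    show "\<gamma> \<in> K \<union> L" if "f \<gamma> + g \<gamma> \<noteq> 0" for \<gamma>
      using K(2)[of \<gamma>] L(2)[of \<gamma>] that by (cases "f \<gamma> = 0") auto
  qed
qed

lemma C_c_zero: "(\<lambda>\<gamma>. 0) \<in> C_c \<G>"
  by (rule C_cI[where K = "{}"]) (auto simp: fun_space_def)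

lemma C_c_sum:
  assumes "\<And>i. i \<in> I \<Longrightarrow> f i \<in> C_c \<G>"
  shows "(\<lambda>\<gamma>. \<Sum>i\<in>I. f i \<gamma>) \<in> C_c \<G>"
  using assms by (induction I rule: infinite_finite_induct) (auto intro: C_c_zero C_c_add)

section \<open>Local injectivity and continuity of range and source; openness of the unit
  space\<close>

lemma rng_local:
  assumes "\<gamma> \<in> arrows \<G>"
  obtains U where "openin (topol \<G>) U" "\<gamma> \<in> U" "inj_on (rng \<G>) U"
    "continuous_map (subtopology (topol \<G>) U) (topol \<G>) (rng \<G>)"
proof -
  obtain U where U: "openin (topol \<G>) U" "\<gamma> \<in> U"
    "homeomorphic_map (subtopology (topol \<G>) U)
       (subtopology (subtopology (topol \<G>) (units \<G>)) (rng \<G> ` U)) (rng \<G>)"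
    using etale assms unfolding local_homeomorphism_def arrows_def by meson
  have "inj_on (rng \<G>) (topspace (subtopology (topol \<G>) U))"
    using U(3) homeomorphic_imp_injective_map by blast
  moreover have "topspace (subtopology (topol \<G>) U) = U"
    using U(1) openin_subset by auto
  \<comment> \<open>The local image carries a subspace topology, so continuity into it is also
    continuity into the full arrow space.\<close>
  ultimately show thesis
    using that U homeomorphic_imp_continuous_map continuous_map_in_subtopology by metis
qed

lemma continuous_rng: "continuous_map (topol \<G>) (topol \<G>) (rng \<G>)"
proof (rule continuous_map_locally_eq)
  fix x assume "x \<in> topspace (topol \<G>)"
  then obtain U where "openin (topol \<G>) U" "x \<in> U"
      "continuous_map (subtopology (topol \<G>) U) (topol \<G>) (rng \<G>)"
    using rng_local unfolding arrows_def by blast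
  then show "\<exists>U g. openin (topol \<G>) U \<and> x \<in> U \<and>
      continuous_map (subtopology (topol \<G>) U) (topol \<G>) g \<and> (\<forall>y\<in>U. rng \<G> y = g y)"
    by blast
qed

lemma continuous_src: "continuous_map (topol \<G>) (topol \<G>) (src \<G>)"
proof -
  \<comment> \<open>The source is the range of the inverse.\<close>
  have "continuous_map (topol \<G>) (topol \<G>) (rng \<G> \<circ> ginv \<G>)"
    by (rule continuous_map_compose[OF continuous_inv continuous_rng])
  then show ?thesis
    by (rule continuous_map_eq) (auto simp: rng_inv arrows_def)
qed

text \<open>Inversion exchanges source and range, so a neighbourhood of the inverse on which the
  range is injective pulls back to one of \<gamma> on which the source is injective.\<close>

lemma src_local:
  assumes "\<gamma> \<in> arrows \<G>"
  obtains U where "openin (topol \<G>) U" "\<gamma> \<in> U" "inj_on (src \<G>) U"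
proof -
  obtain U where U: "openin (topol \<G>) U" "ginv \<G> \<gamma> \<in> U" "inj_on (rng \<G>) U"
    using rng_local[OF inv_closed[OF assms]] by metis
  let ?V = "{\<beta> \<in> topspace (topol \<G>). ginv \<G> \<beta> \<in> U}"
  have "openin (topol \<G>) ?V"
    using openin_continuous_map_preimage[OF continuous_inv U(1)] .
  moreover have "inj_on (src \<G>) ?V"
  proof (rule inj_onI)
    fix a b assume ab: "a \<in> ?V" "b \<in> ?V" "src \<G> a = src \<G> b"
    then have "rng \<G> (ginv \<G> a) = rng \<G> (ginv \<G> b)" by (simp add: rng_inv arrows_def)
    then have "ginv \<G> a = ginv \<G> b" using U(3) ab by (auto dest: inj_onD)
    moreover have "a \<in> arrows \<G>" "b \<in> arrows \<G>" using ab by (auto simp: arrows_def)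
    ultimately show "a = b" using ginv_ginv by metis
  qed
  ultimately show thesis using that U assms by (auto simp: arrows_def)
qed

text \<open>If \<open>r\<close> is injective on \<open>U\<close>, then \<open>\<gamma> = r \<gamma>\<close> whenever both \<open>\<gamma>\<close> and \<open>r \<gamma>\<close> lie in \<open>U\<close>.\<close>

lemma openin_units: "openin (topol \<G>) (units \<G>)"
proof (subst openin_subopen, intro ballI)
  fix x assume x: "x \<in> units \<G>"
  obtain U where U: "openin (topol \<G>) U" "x \<in> U" "inj_on (rng \<G>) U"
    using rng_local units_arrows[OF x] by metis
  let ?V = "U \<inter> {\<beta> \<in> topspace (topol \<G>). rng \<G> \<beta> \<in> U}"
  have "openin (topol \<G>) ?V"
    using openin_continuous_map_preimage[OF continuous_rng U(1)] U(1) by blast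
  moreover have "x \<in> ?V" using x U units_arrows[OF x] by (auto simp: rng_of_unit arrows_def)
  moreover have "?V \<subseteq> units \<G>"
  proof
    fix \<beta> assume \<beta>: "\<beta> \<in> ?V"
    then have "rng \<G> \<beta> = \<beta>"
      using inj_onD[OF U(3), of "rng \<G> \<beta>" \<beta>] rng_rng by (auto simp: arrows_def)
    moreover have "\<beta> \<in> arrows \<G>" using \<beta> by (auto simp: arrows_def)
    ultimately show "\<beta> \<in> units \<G>" using rng_in_units by metis
  qed
  ultimately show "\<exists>T. openin (topol \<G>) T \<and> x \<in> T \<and> T \<subseteq> units \<G>" by blast
qed

section \<open>Bump functions\<close>

text \<open>Locally compact Hausdorff spaces are completely regular. Separating \<gamma> from the
  complement of \<open>U \<inter> V\<close>, where \<open>V\<close> lies in a compact set, controls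
  the support and makes it compact.\<close>

lemma bump_function:
  assumes "openin (topol \<G>) U" "\<gamma> \<in> U"
  obtains p :: "'a \<Rightarrow> real" where "(\<lambda>\<beta>. complex_of_real (p \<beta>)) \<in> C_c \<G>" "p \<gamma> = 1"
    "\<And>\<beta>. 0 \<le> p \<beta>" "\<And>\<beta>. p \<beta> \<le> 1" "\<And>\<beta>. \<beta> \<notin> U \<Longrightarrow> p \<beta> = 0"
proof -
  let ?X = "topol \<G>"
  have g: "\<gamma> \<in> topspace ?X" using openin_subset[OF assms(1)] assms(2) by blast
  obtain V K where V: "openin ?X V" "compactin ?X K" "\<gamma> \<in> V" "V \<subseteq> K"
    using bspec[OF locally_compact[unfolded locally_compact_space_def] g] by blast
  have "closedin ?X (topspace ?X - U \<inter> V)"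
    using openin_Int[OF assms(1) V(1)] by (rule closedin_diff[OF closedin_topspace])
  moreover have "\<gamma> \<in> topspace ?X - (topspace ?X - U \<inter> V)" using assms(2) V(3) g by blast
  moreover have "completely_regular_space ?X"
    using locally_compact Hausdorff by (simp add: locally_compact_regular_imp_completely_regular_space)
  ultimately obtain f :: "'a \<Rightarrow> real" where
    f: "continuous_map ?X (top_of_set {0..1}) f" "f \<gamma> = 0" "f ` (topspace ?X - U \<inter> V) \<subseteq> {1}"
    unfolding completely_regular_space_def by (elim allE impE exE conjE) (rule conjI)
  \<comment> \<open>The separating function is 0 at \<gamma> and 1 off \<open>U \<inter> V\<close>,
    hence the flip; the value 0 off the arrows puts the bump in \<open>fun_space\<close>.\<close>
  define p where "p \<beta> = (if \<beta> \<in> topspace ?X then 1 - f \<beta> else 0)" for \<beta>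
  have zero: "p \<beta> = 0" if "\<beta> \<notin> U \<inter> V" for \<beta> using f(3) that by (auto simp: p_def)
  have cf: "continuous_map ?X euclidean f" using f(1) by (simp add: continuous_map_in_subtopology)
  have fr: "f \<beta> \<in> {0..1}" if "\<beta> \<in> topspace ?X" for \<beta>
    using f(1) that by (auto simp: continuous_map_in_subtopology)
  have "continuous_map ?X euclidean (\<lambda>\<beta>. complex_of_real (1 - f \<beta>))"
    using cf by (auto simp: continuous_map_atin intro!: tendsto_of_real tendsto_diff)
  then have cp: "continuous_map ?X euclidean (\<lambda>\<beta>. complex_of_real (p \<beta>))"
    by (rule continuous_map_eq) (auto simp: p_def)
  have "(\<lambda>\<beta>. complex_of_real (p \<beta>)) \<in> C_c \<G>"
  proof (rule C_cI[OF _ cp V(2)])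
    show "(\<lambda>\<beta>. complex_of_real (p \<beta>)) \<in> fun_space \<G>" by (simp add: fun_space_def p_def arrows_def)
    show "\<beta> \<in> K" if "complex_of_real (p \<beta>) \<noteq> 0" for \<beta> using zero[of \<beta>] that V(4) by auto
  qed
  then show thesis
    by (rule that) (use zero fr f(2) g in \<open>auto simp: p_def\<close>)
qed

lemma unit_bump:
  assumes "x \<in> units \<G>"
  obtains p :: "'a \<Rightarrow> real" where "(\<lambda>\<beta>. complex_of_real (p \<beta>)) \<in> C_c \<G>" "p x = 1"
    "\<And>\<beta>. 0 \<le> p \<beta>" "\<And>\<beta>. p \<beta> \<le> 1" "\<And>\<beta>. \<beta> \<notin> units \<G> \<Longrightarrow> p \<beta> = 0"
  using bump_function[OF openin_units assms] by metis

text \<open>A bump inside a set on which the source is injective restricts to the indicator of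
  \<gamma> on its fibre. Such functions pick single terms out of fibre sums.\<close>

lemma fibre_delta:
  assumes "\<gamma> \<in> arrows \<G>"
  obtains g where "g \<in> C_c \<G>" "g \<gamma> = 1" "\<And>\<beta>. \<beta> \<in> fibre \<G> (src \<G> \<gamma>) \<Longrightarrow> \<beta> \<noteq> \<gamma> \<Longrightarrow> g \<beta> = 0"
proof -
  obtain U where U: "openin (topol \<G>) U" "\<gamma> \<in> U" "inj_on (src \<G>) U"
    using src_local assms by metis
  obtain p :: "'a \<Rightarrow> real" where "(\<lambda>\<beta>. complex_of_real (p \<beta>)) \<in> C_c \<G>" "p \<gamma> = 1"
      "\<And>\<beta>. \<beta> \<notin> U \<Longrightarrow> p \<beta> = 0"
    using bump_function[OF U(1,2)] by metis
  moreover have "\<beta> \<notin> U" if "\<beta> \<in> fibre \<G> (src \<G> \<gamma>)" "\<beta> \<noteq> \<gamma>" for \<beta>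
    using U that by (auto simp: fibre_def inj_on_def)
  ultimately show thesis using that[of "\<lambda>\<beta>. complex_of_real (p \<beta>)"] by auto
qed

section \<open>Elements of the completion as functions\<close>

text \<open>Finitely many open sets with injective source cover \<open>K\<close>, and each of them
  meets a fibre in at most one point.\<close>

lemma finite_compact_Int_fibre:
  assumes "compactin (topol \<G>) K"
  shows "finite (K \<inter> fibre \<G> x)"
proof -
  have sub: "K \<subseteq> arrows \<G>" using assms by (simp add: arrows_def compactin_subset_topspace)
  obtain \<F> where F: "finite \<F>" "\<F> \<subseteq> {U. openin (topol \<G>) U \<and> inj_on (src \<G>) U}" "K \<subseteq> \<Union>\<F>"
  proof -
    let ?\<U> = "{U. openin (topol \<G>) U \<and> inj_on (src \<G>) U}"
    have "K \<subseteq> \<Union>?\<U>"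
    proof
      fix \<gamma> assume "\<gamma> \<in> K"
      then obtain U where "openin (topol \<G>) U" "\<gamma> \<in> U" "inj_on (src \<G>) U"
        using src_local[OF subsetD[OF sub]] by metis
      then show "\<gamma> \<in> \<Union>?\<U>" by blast
    qed
    then have "\<exists>\<F>. finite \<F> \<and> \<F> \<subseteq> ?\<U> \<and> K \<subseteq> \<Union>\<F>"
      by (intro compactinD[OF assms]) auto
    then show thesis using that by blast
  qed
  have "finite (U \<inter> fibre \<G> x)" if "U \<in> \<F>" for U
  proof (rule inj_on_finite[where f = "src \<G>" and B = "{x}"])
    show "inj_on (src \<G>) (U \<inter> fibre \<G> x)" using F(2) that by (blast intro: inj_on_subset)
  qed (auto simp: fibre_def)
  then have "finite (\<Union>U\<in>\<F>. U \<inter> fibre \<G> x)" using F(1) by blast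
  then show ?thesis by (rule finite_subset[rotated]) (use F(3) in auto)
qed

text \<open>An approximant from \<open>C_c\<close> has finite support on each fibre, and the
  difference is square summable by the definition of the norm bound.\<close>

lemma L2_square_summable:
  assumes "\<xi> \<in> L2 \<G>" "x \<in> units \<G>"
  shows "(\<lambda>\<gamma>. (norm (\<xi> \<gamma>))\<^sup>2) summable_on fibre \<G> x"
proof -
  obtain \<eta> where \<eta>: "\<eta> \<in> C_c \<G>" "L2_norm_le \<G> (\<lambda>\<gamma>. \<xi> \<gamma> - \<eta> \<gamma>) 1"
    using assms by (auto simp: L2_def dest!: spec[of _ 1])
  obtain K where K: "compactin (topol \<G>) K" "\<And>\<gamma>. \<eta> \<gamma> \<noteq> 0 \<Longrightarrow> \<gamma> \<in> K"
    using C_c_support[OF \<eta>(1)] by blast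
  have "(\<lambda>\<gamma>. (norm (\<eta> \<gamma>))\<^sup>2) summable_on fibre \<G> x"
    using summable_on_finite[OF finite_compact_Int_fibre[OF K(1), of x]]
    by (rule summable_on_cong_neutral[THEN iffD1, rotated -1]) (use K in auto)
  moreover have "(\<lambda>\<gamma>. (norm (\<xi> \<gamma> - \<eta> \<gamma>))\<^sup>2) summable_on fibre \<G> x"
    using \<eta>(2) assms(2) by (auto simp: L2_norm_le_def)
  ultimately show ?thesis
    using square_summable_add[of "\<lambda>\<gamma>. \<xi> \<gamma> - \<eta> \<gamma>" "fibre \<G> x" \<eta>] by simp
qed

lemma L2_bounded:
  assumes "\<xi> \<in> L2 \<G>"
  obtains B where "\<And>\<gamma>. \<gamma> \<in> arrows \<G> \<Longrightarrow> norm (\<xi> \<gamma>) \<le> B"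
proof -
  obtain \<eta> where \<eta>: "\<eta> \<in> C_c \<G>" "L2_norm_le \<G> (\<lambda>\<gamma>. \<xi> \<gamma> - \<eta> \<gamma>) 1"
    using assms by (auto simp: L2_def dest!: spec[of _ 1])
  obtain B where B: "\<And>\<gamma>. norm (\<eta> \<gamma>) \<le> B"
    using C_c_bounded[OF \<eta>(1)] by (auto simp: bounded_iff)
  have "norm (\<xi> \<gamma>) \<le> 1 + B" if "\<gamma> \<in> arrows \<G>" for \<gamma>
    using L2_norm_le_imp_norm_le[OF \<eta>(2) _ that] B[of \<gamma>] norm_triangle_sub[of "\<xi> \<gamma>" "\<eta> \<gamma>"] by simp
  then show thesis using that by blast
qed

text \<open>Approximation in the module norm is uniform approximation on the arrows, so an e/3
  argument carries continuity over from \<open>C_c\<close>.\<close>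

lemma L2_continuous:
  assumes "\<xi> \<in> L2 \<G>"
  shows "continuous_map (topol \<G>) euclidean \<xi>"
proof -
  have "\<exists>U. openin (topol \<G>) U \<and> x \<in> U \<and> (\<forall>y\<in>U. \<xi> y \<in> Met_TC.mball (\<xi> x) e)"
    if x: "x \<in> topspace (topol \<G>)" and e: "e > 0" for x e
  proof -
    obtain \<eta> where \<eta>: "\<eta> \<in> C_c \<G>" "L2_norm_le \<G> (\<lambda>\<gamma>. \<xi> \<gamma> - \<eta> \<gamma>) (e/3)"
      using assms e by (auto simp: L2_def dest!: spec[of _ "e/3"])
    have d: "dist (\<xi> y) (\<eta> y) \<le> e/3" if "y \<in> topspace (topol \<G>)" for y
      using L2_norm_le_imp_norm_le[OF \<eta>(2)] e that by (simp add: dist_norm arrows_def)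
    obtain U where U: "openin (topol \<G>) U" "x \<in> U" "\<And>y. y \<in> U \<Longrightarrow> dist (\<eta> x) (\<eta> y) < e/3"
    proof -
      have "\<forall>\<epsilon>>0. \<exists>U. openin (topol \<G>) U \<and> x \<in> U \<and> (\<forall>y\<in>U. \<eta> y \<in> Met_TC.mball (\<eta> x) \<epsilon>)"
        using C_c_continuous[OF \<eta>(1)] x
        unfolding mtopology_is_euclidean[symmetric] Met_TC.continuous_map_to_metric by blast
      moreover have "e / 3 > 0" using e by simp
      ultimately obtain U where "openin (topol \<G>) U" "x \<in> U" "\<forall>y\<in>U. \<eta> y \<in> Met_TC.mball (\<eta> x) (e/3)"
        by blast
      then show thesis using that by auto
    qed
    have "dist (\<xi> x) (\<xi> y) < e" if "y \<in> U" for y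
    proof -
      have "y \<in> topspace (topol \<G>)" using U(1) that openin_subset by blast
      then show ?thesis using d[of y] d[OF x] U(3)[OF that]
          dist_triangle[of "\<xi> x" "\<xi> y" "\<eta> x"] dist_triangle[of "\<eta> x" "\<xi> y" "\<eta> y"]
        by (simp add: dist_commute)
    qed
    then show ?thesis using U by auto
  qed
  then show ?thesis
    unfolding mtopology_is_euclidean[symmetric] Met_TC.continuous_map_to_metric by blast
qed

section \<open>Kernels of adjointable operators\<close>

text \<open>Evaluation at \<gamma> is pairing with a function \<open>g\<close> that is the indicator
  of \<gamma> on the fibre. Moving the operator to its adjoint shows that the kernel row is the
  conjugate of \<open>S g\<close>, hence square summable.\<close>

lemma adjointable_kernel:
  assumes "T \<in> adjointable \<G>" "\<gamma> \<in> arrows \<G>"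
  obtains k where "(\<lambda>\<alpha>. (norm (k \<alpha>))\<^sup>2) summable_on fibre \<G> (src \<G> \<gamma>)"
    "\<And>\<xi>. \<xi> \<in> L2 \<G> \<Longrightarrow> T \<xi> \<gamma> = (\<Sum>\<^sub>\<infinity>\<alpha>\<in>fibre \<G> (src \<G> \<gamma>). k \<alpha> * \<xi> \<alpha>)"
proof -
  let ?x = "src \<G> \<gamma>"
  obtain S where S: "S \<in> L2 \<G> \<rightarrow> L2 \<G>"
    "\<And>\<eta> \<xi> x. \<eta> \<in> L2 \<G> \<Longrightarrow> \<xi> \<in> L2 \<G> \<Longrightarrow> x \<in> units \<G> \<Longrightarrow> L2_inner \<G> (T \<eta>) \<xi> x = L2_inner \<G> \<eta> (S \<xi>) x"
    using assms(1) unfolding adjointable_def by blast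
  have x: "?x \<in> units \<G>" using assms(2) by (rule src_in_units)
  obtain g where g: "g \<in> C_c \<G>" "g \<gamma> = 1" "\<And>\<beta>. \<beta> \<in> fibre \<G> ?x \<Longrightarrow> \<beta> \<noteq> \<gamma> \<Longrightarrow> g \<beta> = 0"
    using fibre_delta[OF assms(2)] by blast
  have gL: "g \<in> L2 \<G>" using g(1) C_c_subset_L2 by blast
  define k where "k \<alpha> = cnj (S g \<alpha>)" for \<alpha>
  have "S g \<in> L2 \<G>" using S(1) gL by blast
  then have "(\<lambda>\<alpha>. (norm (k \<alpha>))\<^sup>2) summable_on fibre \<G> ?x"
    using L2_square_summable[OF _ x] by (simp add: k_def)
  moreover have "T \<xi> \<gamma> = (\<Sum>\<^sub>\<infinity>\<alpha>\<in>fibre \<G> ?x. k \<alpha> * \<xi> \<alpha>)" if \<xi>: "\<xi> \<in> L2 \<G>" for \<xi>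
  proof -
    \<comment> \<open>Only the term at \<gamma> survives, with
      \<open>g \<gamma> = 1\<close>.\<close>
    have "((\<lambda>\<alpha>. cnj (T \<xi> \<alpha>) * g \<alpha>) has_sum (cnj (T \<xi> \<gamma>) * g \<gamma>)) (fibre \<G> ?x)"
      by (rule has_sum_single) (use g(3) self_in_fibre assms(2) in auto)
    then have "cnj (T \<xi> \<gamma>) = L2_inner \<G> (T \<xi>) g ?x"
      unfolding L2_inner_def using g(2) by (simp add: infsumI)
    also have "\<dots> = (\<Sum>\<^sub>\<infinity>\<alpha>\<in>fibre \<G> ?x. cnj (k \<alpha> * \<xi> \<alpha>))"
      using S(2)[OF \<xi> gL x] by (simp add: L2_inner_def k_def mult.commute)
    also have "\<dots> = cnj (\<Sum>\<^sub>\<infinity>\<alpha>\<in>fibre \<G> ?x. k \<alpha> * \<xi> \<alpha>)" by (rule infsum_cnj)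
    finally show ?thesis by simp
  qed
  ultimately show thesis by (rule that)
qed

section \<open>Functions supported on the unit space\<close>

text \<open>The only unit in the fibre is s(\<gamma>), and dividing \<gamma> by it changes
  nothing.\<close>

lemma convolution_unit_supported:
  fixes f h :: "_ \<Rightarrow> complex"
  assumes "\<And>\<beta>. \<beta> \<notin> units \<G> \<Longrightarrow> h \<beta> = 0" "\<gamma> \<in> arrows \<G>"
  shows "(\<Sum>\<^sub>\<infinity>\<alpha>\<in>fibre \<G> (src \<G> \<gamma>). f (\<gamma> \<odot> ginv \<G> \<alpha>) * h \<alpha>) = f \<gamma> * h (src \<G> \<gamma>)"
proof -
  have "((\<lambda>\<alpha>. f (\<gamma> \<odot> ginv \<G> \<alpha>) * h \<alpha>) has_sum
      f (\<gamma> \<odot> ginv \<G> (src \<G> \<gamma>)) * h (src \<G> \<gamma>)) (fibre \<G> (src \<G> \<gamma>))"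
    by (rule has_sum_single[where i = "src \<G> \<gamma>"])
       (use assms(1) unit_in_fibre src_in_fibre[OF assms(2)] in fastforce)+
  then show ?thesis using mult_src_inv[OF assms(2)] by (simp add: infsumI)
qed

text \<open>The quotient of \<gamma> by \<beta> is a unit only for \<beta> = \<gamma>, where it is
  r(\<gamma>).\<close>

lemma right_conv_unit_supported:
  assumes "\<And>\<beta>. \<beta> \<notin> units \<G> \<Longrightarrow> h \<beta> = 0" "\<gamma> \<in> arrows \<G>"
  shows "right_conv \<G> g h \<gamma> = g \<gamma> * h (rng \<G> \<gamma>)"
proof -
  have "((\<lambda>\<beta>. g \<beta> * h (\<gamma> \<odot> ginv \<G> \<beta>)) has_sum g \<gamma> * h (\<gamma> \<odot> ginv \<G> \<gamma>)) (fibre \<G> (src \<G> \<gamma>))"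
  proof (rule has_sum_single)
    fix \<beta> assume "\<beta> \<in> fibre \<G> (src \<G> \<gamma>)" "\<beta> \<noteq> \<gamma>"
    then have "\<gamma> \<odot> ginv \<G> \<beta> \<notin> units \<G>" using div_unit_imp_eq[OF assms(2)] by blast
    then show "g \<beta> * h (\<gamma> \<odot> ginv \<G> \<beta>) = 0" using assms(1) by simp
  qed (use self_in_fibre assms(2) in blast)
  then show ?thesis using assms(2) by (simp add: right_conv_def mult_inv infsumI)
qed

text \<open>The partial sums lie in \<open>C_c\<close>. The tails are uniformly small and supported
  on the units, so they are small in the module norm too.\<close>

lemma L2_unit_series:
  fixes p :: "nat \<Rightarrow> _ \<Rightarrow> real"
  assumes "\<And>n. (\<lambda>\<beta>. complex_of_real (p n \<beta>)) \<in> C_c \<G>"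
    and "\<And>n \<beta>. 0 \<le> p n \<beta>" "\<And>n \<beta>. p n \<beta> \<le> 1" "\<And>n \<beta>. \<beta> \<notin> units \<G> \<Longrightarrow> p n \<beta> = 0"
  shows "(\<lambda>\<beta>. complex_of_real (\<Sum>n. (1/2) ^ n * p n \<beta>)) \<in> L2 \<G>"
  unfolding L2_def
proof (intro CollectI conjI allI impI)
  let ?f = "\<lambda>\<beta> n. (1/2) ^ n * p n \<beta>"
  let ?h = "\<lambda>\<beta>. complex_of_real (\<Sum>n. ?f \<beta> n)"
  show "?h \<in> fun_space \<G>"
    using assms(4) units_arrows by (fastforce simp: fun_space_def)
  fix e :: real assume "e > 0"
  \<comment> \<open>The tail from index \<open>N\<close> is bounded by the geometric sum
    \<open>2 * (1/2) ^ N\<close>, hence the bound e/2.\<close>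
  then obtain N where N: "(1/2) ^ N < e / 2"
    using real_arch_pow_inv[of "e/2" "1/2"] by auto
  define \<eta> where "\<eta> \<beta> = (\<Sum>n<N. complex_of_real (p n \<beta>) * complex_of_real ((1/2) ^ n))" for \<beta>
  have "\<eta> \<in> C_c \<G>"
    unfolding \<eta>_def by (intro C_c_sum C_c_mult assms(1)) simp
  moreover have "L2_norm_le \<G> (\<lambda>\<beta>. ?h \<beta> - \<eta> \<beta>) e"
  proof (rule L2_norm_le_units)
    fix \<beta>
    have le: "?f \<beta> n \<le> (1/2) ^ n" for n
      using mult_left_mono[OF assms(3)[of n \<beta>], of "(1/2) ^ n"] by simp
    have s: "summable (?f \<beta>)"
      by (rule summable_comparison_test'[of "\<lambda>n. (1/2) ^ n" 0])
         (use le assms(2) in \<open>auto intro: summable_geometric\<close>)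
    have s_tail: "summable (\<lambda>n. ?f \<beta> (n + N))" using s by (rule summable_ignore_initial_segment)
    have geometric: "summable (\<lambda>n. (1/2) ^ N * (1/2) ^ n :: real)"
      by (intro summable_mult summable_geometric) simp
    have "?h \<beta> - \<eta> \<beta> = complex_of_real (\<Sum>n. ?f \<beta> (n + N))"
      using suminf_split_initial_segment[OF s, of N] by (simp add: \<eta>_def mult.commute)
    then have "norm (?h \<beta> - \<eta> \<beta>) = \<bar>\<Sum>n. ?f \<beta> (n + N)\<bar>" by (metis norm_of_real)
    also have "\<dots> = (\<Sum>n. ?f \<beta> (n + N))"
      using assms(2) by (intro abs_of_nonneg suminf_nonneg s_tail) simp
    also have "\<dots> \<le> (\<Sum>n. (1/2) ^ N * (1/2) ^ n)"
      using le by (intro suminf_le s_tail geometric) (simp flip: power_add add: add.commute)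
    also have "\<dots> = (1/2) ^ N * 2"
      using suminf_mult[OF summable_geometric, of "1/2::real" "(1/2) ^ N"] suminf_geometric[of "1/2::real"] by simp
    also have "\<dots> \<le> e" using N by simp
    finally show "norm (?h \<beta> - \<eta> \<beta>) \<le> e" .
  qed (simp add: assms(4) \<eta>_def)
  ultimately show "\<exists>\<eta>\<in>C_c \<G>. L2_norm_le \<G> (\<lambda>\<beta>. ?h \<beta> - \<eta> \<beta>) e" by blast
qed

text \<open>
  If \<open>f\<close> exceeded \<open>4\<^sup>n\<close> at \<open>\<gamma>\<^sub>n\<close>, a sum of bumps at the sources of the \<open>\<gamma>\<^sub>n\<close> with weights
  \<open>2\<^sup>-\<^sup>n\<close> would be mapped to an unbounded function. This replaces boundedness of the operator.
\<close>

lemma bounded_unit_multiplier: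
  fixes f :: "_ \<Rightarrow> complex"
  assumes "\<And>h. h \<in> L2 \<G> \<Longrightarrow> (\<And>\<beta>. \<beta> \<notin> units \<G> \<Longrightarrow> h \<beta> = 0) \<Longrightarrow>
    \<exists>\<xi>\<in>L2 \<G>. \<forall>\<gamma>\<in>arrows \<G>. \<xi> \<gamma> = f \<gamma> * h (src \<G> \<gamma>)"
  shows "bounded (f ` arrows \<G>)"
proof (rule ccontr)
  assume "\<not> ?thesis"
  then have "\<exists>\<gamma>\<in>arrows \<G>. norm (f \<gamma>) > 4 ^ n" for n :: nat
    unfolding bounded_iff by (metis imageE not_le)
  then obtain c where c: "\<And>n. c n \<in> arrows \<G>" "\<And>n::nat. norm (f (c n)) > 4 ^ n" by metis
  have "\<exists>p::_ \<Rightarrow> real. (\<lambda>\<beta>. complex_of_real (p \<beta>)) \<in> C_c \<G> \<and> p (src \<G> (c n)) = 1 \<and>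
      (\<forall>\<beta>. 0 \<le> p \<beta>) \<and> (\<forall>\<beta>. p \<beta> \<le> 1) \<and> (\<forall>\<beta>. \<beta> \<notin> units \<G> \<longrightarrow> p \<beta> = 0)" for n
    by (rule unit_bump[OF src_in_units[OF c(1)[of n]]]) blast
  then obtain p :: "nat \<Rightarrow> _ \<Rightarrow> real" where p: "\<And>n. (\<lambda>\<beta>. complex_of_real (p n \<beta>)) \<in> C_c \<G>"
    "\<And>n. p n (src \<G> (c n)) = 1" "\<And>n \<beta>. 0 \<le> p n \<beta>" "\<And>n \<beta>. p n \<beta> \<le> 1"
    "\<And>n \<beta>. \<beta> \<notin> units \<G> \<Longrightarrow> p n \<beta> = 0"
    by metis
  define q where "q \<beta> = (\<Sum>n. (1/2) ^ n * p n \<beta>)" for \<beta>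
  have "(\<lambda>\<beta>. complex_of_real (q \<beta>)) \<in> L2 \<G>"
    unfolding q_def by (rule L2_unit_series) (use p in auto)
  then obtain \<xi> where \<xi>: "\<xi> \<in> L2 \<G>" "\<And>\<gamma>. \<gamma> \<in> arrows \<G> \<Longrightarrow> \<xi> \<gamma> = f \<gamma> * complex_of_real (q (src \<G> \<gamma>))"
    using assms[of "\<lambda>\<beta>. complex_of_real (q \<beta>)"] p(5) by (auto simp: q_def)
  obtain B where B: "\<And>\<gamma>. \<gamma> \<in> arrows \<G> \<Longrightarrow> norm (\<xi> \<gamma>) \<le> B" using L2_bounded[OF \<xi>(1)] by blast
  have "2 ^ n \<le> B" for n
  proof -
    let ?x = "src \<G> (c n)"
    have s: "summable (\<lambda>m. (1/2) ^ m * p m ?x)"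
      by (rule summable_comparison_test'[of "\<lambda>n. (1/2) ^ n" 0])
         (use p(3) mult_left_mono[OF p(4)] in \<open>auto intro: summable_geometric\<close>)
    \<comment> \<open>All terms are nonnegative, so the n-th one alone bounds \<open>q\<close> from
      below; the n-th bump equals 1 at this point.\<close>
    have "(\<Sum>m\<in>{n}. (1/2) ^ m * p m ?x) \<le> q ?x"
      unfolding q_def by (rule sum_le_suminf[OF s]) (use p(3) in auto)
    then have q: "(1/2) ^ n \<le> q ?x" using p(2) by simp
    have "(2::real) ^ n = 4 ^ n * (1/2) ^ n" by (simp flip: power_mult_distrib)
    also have "\<dots> \<le> norm (f (c n)) * q ?x"
      using c(2)[of n] q by (intro mult_mono) auto
    also have "\<dots> \<le> norm (\<xi> (c n))"
      using \<xi>(2)[OF c(1)] by (simp add: norm_mult mult_left_mono)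
    also have "\<dots> \<le> B" using B c(1) by blast
    finally show ?thesis .
  qed
  moreover obtain n where "B < 2 ^ n" using real_arch_pow[of 2 B] by auto
  ultimately show False by (meson not_le)
qed

section \<open>Invariance of the kernel and continuity of the multiplier\<close>

text \<open>Take \<open>h\<close> on the units with value 1 at r(\<alpha>), and \<open>g\<close> the
  indicator of \<alpha> on the fibre. Evaluating both sides of equivariance for \<open>g\<close> and
  \<open>h\<close> at \<gamma> isolates one kernel value on each side.\<close>

lemma equivariant_kernel:
  assumes eq: "equivariant \<G> T"
    and K: "\<And>\<gamma> \<xi>. \<gamma> \<in> arrows \<G> \<Longrightarrow> \<xi> \<in> L2 \<G> \<Longrightarrow>
      T \<xi> \<gamma> = (\<Sum>\<^sub>\<infinity>\<alpha>\<in>fibre \<G> (src \<G> \<gamma>). K \<gamma> \<alpha> * \<xi> \<alpha>)"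
    and \<gamma>: "\<gamma> \<in> arrows \<G>" and \<alpha>: "\<alpha> \<in> fibre \<G> (src \<G> \<gamma>)"
  shows "K \<gamma> \<alpha> = K (\<gamma> \<odot> ginv \<G> \<alpha>) (rng \<G> \<alpha>)"
proof -
  let ?A = "fibre \<G> (src \<G> \<gamma>)" and ?\<delta> = "\<gamma> \<odot> ginv \<G> \<alpha>"
  have a: "\<alpha> \<in> arrows \<G>" "src \<G> \<alpha> = src \<G> \<gamma>" using \<alpha> by (auto simp: fibre_def)
  have d: "?\<delta> \<in> arrows \<G>" "src \<G> ?\<delta> = rng \<G> \<alpha>" using div_closed[OF \<gamma> \<alpha>] by auto
  obtain p :: "_ \<Rightarrow> real" where p: "(\<lambda>\<beta>. complex_of_real (p \<beta>)) \<in> C_c \<G>" "p (rng \<G> \<alpha>) = 1"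
    "\<And>\<beta>. \<beta> \<notin> units \<G> \<Longrightarrow> p \<beta> = 0"
    by (rule unit_bump[OF rng_in_units[OF a(1)]]) blast
  define h where "h \<beta> = complex_of_real (p \<beta>)" for \<beta>
  have h: "h \<in> C_c \<G>" "h (rng \<G> \<alpha>) = 1" "\<And>\<beta>. \<beta> \<notin> units \<G> \<Longrightarrow> h \<beta> = 0"
    using p unfolding h_def by auto
  have hL: "h \<in> L2 \<G>" using h(1) C_c_subset_L2 by blast
  obtain g where g: "g \<in> C_c \<G>" "g \<alpha> = 1" "\<And>\<beta>. \<beta> \<in> ?A \<Longrightarrow> \<beta> \<noteq> \<alpha> \<Longrightarrow> g \<beta> = 0"
    using fibre_delta[OF a(1)] unfolding a(2) by blast
  \<comment> \<open>Right convolution of a unit-supported function is a pointwise product, which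
    shows that the result stays in \<open>C_c\<close> and that the kernel formula for
    \<open>T\<close> applies to it.\<close>
  have rc: "right_conv \<G> g h = (\<lambda>\<beta>. g \<beta> * (h \<circ> rng \<G>) \<beta>)"
  proof
    fix \<beta> show "right_conv \<G> g h \<beta> = g \<beta> * (h \<circ> rng \<G>) \<beta>"
    proof (cases "\<beta> \<in> arrows \<G>")
      case True
      then show ?thesis using right_conv_unit_supported[of h \<beta> g] h(3) by simp
    next
      case False
      then show ?thesis using C_c_fun_space[OF g(1)] by (simp add: right_conv_def fun_space_def)
    qed
  qed
  have "right_conv \<G> g h \<in> C_c \<G>"
    unfolding rc
    by (rule C_c_mult[OF g(1) continuous_map_compose[OF continuous_rng C_c_continuous[OF h(1)]]])
  then have "T (right_conv \<G> g h) \<gamma> = (\<Sum>\<^sub>\<infinity>\<beta>\<in>?A. K \<gamma> \<beta> * right_conv \<G> g h \<beta>)"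
    using K[OF \<gamma>] C_c_subset_L2 by blast
  moreover have "((\<lambda>\<beta>. K \<gamma> \<beta> * right_conv \<G> g h \<beta>) has_sum K \<gamma> \<alpha> * right_conv \<G> g h \<alpha>) ?A"
    by (rule has_sum_single[OF \<alpha>]) (simp add: rc g(3))
  ultimately have 1: "T (right_conv \<G> g h) \<gamma> = K \<gamma> \<alpha>"
    using g(2) h(2) by (simp add: rc infsumI)
  have "((\<lambda>\<beta>. g \<beta> * T h (\<gamma> \<odot> ginv \<G> \<beta>)) has_sum g \<alpha> * T h ?\<delta>) ?A"
    by (rule has_sum_single[OF \<alpha>]) (simp add: g(3))
  then have 2: "right_conv \<G> g (T h) \<gamma> = T h ?\<delta>"
    using \<gamma> g(2) by (simp add: right_conv_def infsumI)
  \<comment> \<open>Here \<open>h\<close> is nonzero at most at the one unit of this fibre,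
    r(\<alpha>).\<close>
  have "((\<lambda>\<beta>. K ?\<delta> \<beta> * h \<beta>) has_sum K ?\<delta> (rng \<G> \<alpha>) * h (rng \<G> \<alpha>)) (fibre \<G> (rng \<G> \<alpha>))"
  proof (rule has_sum_single)
    show "rng \<G> \<alpha> \<in> fibre \<G> (rng \<G> \<alpha>)" using src_in_fibre[OF d(1)] d(2) by simp
    show "K ?\<delta> \<beta> * h \<beta> = 0" if "\<beta> \<in> fibre \<G> (rng \<G> \<alpha>)" "\<beta> \<noteq> rng \<G> \<alpha>" for \<beta>
      using unit_in_fibre[OF that(1)] that(2) h(3)[of \<beta>] by auto
  qed
  then have 3: "T h ?\<delta> = K ?\<delta> (rng \<G> \<alpha>)"
    using K[OF d(1) hL] d(2) h(2) by (simp add: infsumI)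
  have "T (right_conv \<G> g h) = right_conv \<G> g (T h)"
    using eq g(1) hL unfolding equivariant_def by blast
  then show ?thesis using 1 2 3 by simp
qed

text \<open>For \<open>h\<close> on the units with value 1 at s(\<gamma>), near \<gamma> the
  function \<open>f\<close> is the quotient of an element of \<open>L2\<close>, which is continuous,
  by the nonvanishing continuous function \<open>h \<circ> src \<G>\<close>.\<close>

lemma unit_multiplier_continuous:
  fixes f :: "_ \<Rightarrow> complex"
  assumes "\<And>h. h \<in> L2 \<G> \<Longrightarrow> (\<And>\<beta>. \<beta> \<notin> units \<G> \<Longrightarrow> h \<beta> = 0) \<Longrightarrow>
    \<exists>\<xi>\<in>L2 \<G>. \<forall>\<gamma>\<in>arrows \<G>. \<xi> \<gamma> = f \<gamma> * h (src \<G> \<gamma>)"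
  shows "continuous_map (topol \<G>) euclidean f"
proof (rule continuous_map_locally_eq)
  let ?X = "topol \<G>"
  fix \<gamma> assume "\<gamma> \<in> topspace ?X"
  then have \<gamma>: "\<gamma> \<in> arrows \<G>" by (simp add: arrows_def)
  obtain p :: "_ \<Rightarrow> real" where p: "(\<lambda>\<beta>. complex_of_real (p \<beta>)) \<in> C_c \<G>" "p (src \<G> \<gamma>) = 1"
    "\<And>\<beta>. \<beta> \<notin> units \<G> \<Longrightarrow> p \<beta> = 0"
    by (rule unit_bump[OF src_in_units[OF \<gamma>]]) blast
  define h where "h \<beta> = complex_of_real (p \<beta>)" for \<beta>
  have h: "h \<in> C_c \<G>" "h (src \<G> \<gamma>) = 1" "\<And>\<beta>. \<beta> \<notin> units \<G> \<Longrightarrow> h \<beta> = 0"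
    using p unfolding h_def by auto
  obtain \<xi> where \<xi>: "\<xi> \<in> L2 \<G>" "\<And>\<beta>. \<beta> \<in> arrows \<G> \<Longrightarrow> \<xi> \<beta> = f \<beta> * h (src \<G> \<beta>)"
    using assms[of h] h(1,3) C_c_subset_L2 by blast
  have ch: "continuous_map ?X euclidean (h \<circ> src \<G>)"
    by (rule continuous_map_compose[OF continuous_src C_c_continuous[OF h(1)]])
  define U where "U = {\<beta> \<in> topspace ?X. (h \<circ> src \<G>) \<beta> \<in> - {0}}"
  have "openin ?X U" unfolding U_def
    by (rule openin_continuous_map_preimage[OF ch]) (simp add: open_openin[symmetric] open_Compl)
  moreover have "\<gamma> \<in> U" using \<gamma> h(2) by (simp add: U_def arrows_def)
  moreover have "continuous_map (subtopology ?X U) euclidean (\<lambda>\<beta>. \<xi> \<beta> * inverse ((h \<circ> src \<G>) \<beta>))"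
  proof (rule continuous_map_euclidean_mult)
    show "continuous_map (subtopology ?X U) euclidean \<xi>"
      using L2_continuous[OF \<xi>(1)] by (rule continuous_map_from_subtopology)
    have "continuous_map (subtopology ?X U) euclidean (h \<circ> src \<G>)"
      using ch by (rule continuous_map_from_subtopology)
    then show "continuous_map (subtopology ?X U) euclidean (\<lambda>\<beta>. inverse ((h \<circ> src \<G>) \<beta>))"
      by (auto simp: continuous_map_atin U_def o_def intro!: tendsto_inverse)
  qed
  moreover have "\<forall>\<beta>\<in>U. f \<beta> = \<xi> \<beta> * inverse ((h \<circ> src \<G>) \<beta>)"
    using \<xi>(2) by (simp add: U_def arrows_def)
  ultimately show "\<exists>U g. openin ?X U \<and> \<gamma> \<in> U \<and> continuous_map (subtopology ?X U) euclidean g \<and> (\<forall>\<beta>\<in>U. f \<beta> = g \<beta>)"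
    by blast
qed

section \<open>Existence and uniqueness of the convolving function\<close>

lemma equivariant_convolution:
  assumes "T \<in> adjointable \<G>" "equivariant \<G> T"
  shows "\<exists>!f. f \<in> C_b \<G> \<and>
    (\<forall>\<xi> \<in> L2 \<G>. \<forall>\<gamma> \<in> arrows \<G>.
      (\<lambda>\<alpha>. norm (f (\<gamma> \<odot> ginv \<G> \<alpha>) * \<xi> \<alpha>)) summable_on fibre \<G> (src \<G> \<gamma>) \<and>
      T \<xi> \<gamma> = (\<Sum>\<^sub>\<infinity>\<alpha>\<in>fibre \<G> (src \<G> \<gamma>). f (\<gamma> \<odot> ginv \<G> \<alpha>) * \<xi> \<alpha>))" (is "\<exists>!f. ?P f")
proof (rule ex_ex1I)
  have "\<exists>k. (\<lambda>\<alpha>. (norm (k \<alpha>))\<^sup>2) summable_on fibre \<G> (src \<G> \<gamma>) \<and>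
      (\<forall>\<xi>\<in>L2 \<G>. T \<xi> \<gamma> = (\<Sum>\<^sub>\<infinity>\<alpha>\<in>fibre \<G> (src \<G> \<gamma>). k \<alpha> * \<xi> \<alpha>))"
    if "\<gamma> \<in> arrows \<G>" for \<gamma>
    by (rule adjointable_kernel[OF assms(1) that]) blast
  then obtain K where
    K: "\<And>\<gamma>. \<gamma> \<in> arrows \<G> \<Longrightarrow> (\<lambda>\<alpha>. (norm (K \<gamma> \<alpha>))\<^sup>2) summable_on fibre \<G> (src \<G> \<gamma>)"
      "\<And>\<gamma> \<xi>. \<gamma> \<in> arrows \<G> \<Longrightarrow> \<xi> \<in> L2 \<G> \<Longrightarrow> T \<xi> \<gamma> = (\<Sum>\<^sub>\<infinity>\<alpha>\<in>fibre \<G> (src \<G> \<gamma>). K \<gamma> \<alpha> * \<xi> \<alpha>)"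
    by metis
  \<comment> \<open>A convolution kernel at (\<gamma>, s(\<gamma>)) has the value of its function at
    \<gamma>, which forces this choice; 0 off the arrows is the convention of
    \<open>fun_space\<close>.\<close>
  define f where "f \<gamma> = (if \<gamma> \<in> arrows \<G> then K \<gamma> (src \<G> \<gamma>) else 0)" for \<gamma>
  have Kf: "f (\<gamma> \<odot> ginv \<G> \<alpha>) = K \<gamma> \<alpha>" if "\<gamma> \<in> arrows \<G>" "\<alpha> \<in> fibre \<G> (src \<G> \<gamma>)" for \<gamma> \<alpha>
    using div_closed[OF that] by (simp add: f_def flip: equivariant_kernel[OF assms(2) K(2) that])
  have conv: "T \<xi> \<gamma> = (\<Sum>\<^sub>\<infinity>\<alpha>\<in>fibre \<G> (src \<G> \<gamma>). f (\<gamma> \<odot> ginv \<G> \<alpha>) * \<xi> \<alpha>)"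
    if "\<xi> \<in> L2 \<G>" "\<gamma> \<in> arrows \<G>" for \<xi> \<gamma>
    unfolding K(2)[OF that(2,1)] by (rule infsum_cong) (simp add: Kf[OF that(2)])
  have summ: "(\<lambda>\<alpha>. norm (f (\<gamma> \<odot> ginv \<G> \<alpha>) * \<xi> \<alpha>)) summable_on fibre \<G> (src \<G> \<gamma>)"
    if "\<xi> \<in> L2 \<G>" "\<gamma> \<in> arrows \<G>" for \<xi> \<gamma>
  proof -
    have "(\<lambda>\<alpha>. norm (K \<gamma> \<alpha> * \<xi> \<alpha>)) summable_on fibre \<G> (src \<G> \<gamma>)"
      by (rule square_summable_imp_abs_summable_mult[OF K(1)[OF that(2)]
            L2_square_summable[OF that(1) src_in_units[OF that(2)]]])
    then show ?thesis
      by (rule summable_on_cong[THEN iffD1, rotated]) (simp add: Kf[OF that(2)])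
  qed
  \<comment> \<open>On unit-supported functions \<open>T\<close> acts as multiplication by
    \<open>f\<close> after pulling back along the source. This is the common hypothesis of the
    continuity and boundedness lemmas, with witness \<open>T h\<close>.\<close>
  have "\<exists>\<xi>\<in>L2 \<G>. \<forall>\<gamma>\<in>arrows \<G>. \<xi> \<gamma> = f \<gamma> * h (src \<G> \<gamma>)"
    if h: "h \<in> L2 \<G>" "\<And>\<beta>. \<beta> \<notin> units \<G> \<Longrightarrow> h \<beta> = 0" for h
  proof
    show "T h \<in> L2 \<G>" using assms(1) h(1) unfolding adjointable_def by blast
    show "\<forall>\<gamma>\<in>arrows \<G>. T h \<gamma> = f \<gamma> * h (src \<G> \<gamma>)"
      using conv[OF h(1)] convolution_unit_supported[where h = h, OF h(2)] by simp
  qed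
  then have "continuous_map (topol \<G>) euclidean f" "bounded (f ` arrows \<G>)"
    using unit_multiplier_continuous bounded_unit_multiplier by blast+
  then have "f \<in> C_b \<G>" by (simp add: C_b_def fun_space_def f_def)
  with conv summ show "\<exists>f. ?P f"
    by blast
next
  fix f f'
  assume f: "?P f" and f': "?P f'"
  show "f = f'"
  proof
    fix \<gamma> show "f \<gamma> = f' \<gamma>"
    proof (cases "\<gamma> \<in> arrows \<G>")
      case True
      \<comment> \<open>A bump on the units with value 1 at s(\<gamma>) recovers the value of either
        candidate at \<gamma> from \<open>T\<close>.\<close>
      obtain p :: "_ \<Rightarrow> real" where p: "(\<lambda>\<beta>. complex_of_real (p \<beta>)) \<in> C_c \<G>" "p (src \<G> \<gamma>) = 1"
        "\<And>\<beta>. \<beta> \<notin> units \<G> \<Longrightarrow> p \<beta> = 0"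
        by (rule unit_bump[OF src_in_units[OF True]]) blast
      let ?h = "\<lambda>\<beta>. complex_of_real (p \<beta>)"
      have h: "?h \<in> L2 \<G>" using p(1) C_c_subset_L2 by auto
      have "T ?h \<gamma> = f \<gamma> * ?h (src \<G> \<gamma>)"
        using bspec[OF bspec[OF conjunct2[OF f] h] True]
          convolution_unit_supported[where f = f and h = ?h, OF _ True] p(3) by simp
      moreover have "T ?h \<gamma> = f' \<gamma> * ?h (src \<G> \<gamma>)"
        using bspec[OF bspec[OF conjunct2[OF f'] h] True]
          convolution_unit_supported[where f = f' and h = ?h, OF _ True] p(3) by simp
      ultimately show ?thesis using p(2) by simp
    qed (use f f' in \<open>simp add: C_b_def fun_space_def\<close>)
  qed
qed

end

theorem propositionB:
  fixes \<G> :: "'g top_groupoid"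
    and T :: "('g \<Rightarrow> complex) \<Rightarrow> ('g \<Rightarrow> complex)"
  assumes "lc_etale_groupoid \<G>"
    and "T \<in> adjointable \<G>"
    and "equivariant \<G> T"
  shows "\<exists>!f. f \<in> C_b \<G> \<and>
    (\<forall>\<xi> \<in> L2 \<G>. \<forall>\<gamma> \<in> arrows \<G>.
      (\<lambda>\<alpha>. norm (f (\<gamma> \<odot>\<^bsub>\<G>\<^esub> ginv \<G> \<alpha>) * \<xi> \<alpha>)) summable_on fibre \<G> (src \<G> \<gamma>) \<and>
      T \<xi> \<gamma> = (\<Sum>\<^sub>\<infinity>\<alpha>\<in>fibre \<G> (src \<G> \<gamma>). f (\<gamma> \<odot>\<^bsub>\<G>\<^esub> ginv \<G> \<alpha>) * \<xi> \<alpha>))"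
  using assms by (rule lc_etale_groupoid.equivariant_convolution)

end
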